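(* Consider the discrete-space/continuous-time Lagrangian on $T\mathcal{D}(\mathbb{M})$ $$\mathcal{L}_h(A)=\tfrac12\langle\!\langle A^\flat,A\rangle\!\rangle,$$ where $q\in\mathcal{D}(\mathbb{M})$, $A=-\dot qq^{-1}\in\mathcal{S}$ is a sparse, null-row and $\Omega$-antisymmetric matrix, and $A^\flat$ is the discrete flat operator applied to $A$. Let $q(t)$, $t\in[0,1]$, be a smooth curve in $\mathcal{D}(\mathbb{M})$ satisfying the Lagrange--d'Alembert principle $$\delta\int_0^1\mathcal{L}_h(A)\,dt=0,\qquad \delta q\in S_q,\quad A\in\mathcal{S},\quad \delta q(0)=\delta q(1)=0 .$$ Then there is a discrete pressure field $p=p(t)\in\mathbb{R}^N$ (enforcing $A\in\mathcal{S}$) such that $$\left(\dot A^\flat+\mathbf{L}_AA^\flat+\mathbf{d}p\right)_{ij}=0\quad\text{for all } i \text{ and all } j\in N(i),$$ or, equivalently, $$\dot A_{ij}+\frac{|S_{ij}|}{2\Omega_i\Omega_j|e_{ij}|}[A,A^\flat\Omega]_{ij}+\frac{|S_{ij}|}{2\Omega_i|e_{ij}|}(p_j-p_i)=0\quad\text{for all } i \text{ and all } j\in N(i).$$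
   Context: Mesh. $\mathbb{M}$ is a mesh (simplicial or Cartesian, Delaunay with well-shaped elements) with cells $C_1,\dots,C_N$; $\Omega$ is the diagonal matrix with $\Omega_{ii}=\Omega_i=|C_i|$; $N(i)$ is the set of indices of cells sharing a face with $C_i$; for $j\in N(i)$, $S_{ij}=C_i\cap C_j$ is the common face, of area $|S_{ij}|$, and $e_{ij}$ is the dual edge (joining the circumcenters of $C_i$ and $C_j$), of length $|e_{ij}|$. Group and constraints. $\mathcal{D}(\mathbb{M})$ is the Lie group of real $N\times N$ matrices $q$ of determinant $1$ with $q^T\Omega q=\Omega$ and $\sum_jq_{ij}=1$ for all $i$; its Lie algebra $\mathfrak{D}(\mathbb{M})$ consists of matrices $A$ with $A^T\Omega+\Omega A=0$ ($\Omega$-antisymmetric) and $\sum_jA_{ij}=0$ (null-row). $\mathcal{S}$ is the set of $A\in\mathfrak{D}(\mathbb{M})$ with $A_{ij}\ne0\Rightarrow j\in N(i)$. $S_q=\{X\in T_q\mathcal{D}(\mathbb{M}): Xq^{-1}\in\mathcal{S}\}$. Discrete forms. $0$-forms are vectors in $\mathbb{R}^N$, $1$-forms are antisymmetric matrices $F$, $2$-forms are completely antisymmetric $3$-tensors $G$. $(\mathbf{d}f)_{ij}=f_j-f_i$, $(\mathbf{d}F)_{ijk}=F_{ij}+F_{jk}+F_{ki}$; $(\mathbf{i}_AF)_i=(AF^T)_{ii}$, $(\mathbf{i}_AG)_{ij}=\sum_k(G_{ikj}A_{ik}-G_{jki}A_{jk})$; $\mathbf{L}_AF=\mathbf{i}_A\mathbf{d}F+\mathbf{d}\mathbf{i}_AF$;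 $\langle\!\langle F,X\rangle\!\rangle=\mathrm{Tr}(\Omega XF^T)$. $[X,Y]=XY-YX$. Flat operator. $A\mapsto A^\flat$ is the linear map from $\mathcal{S}$ to antisymmetric $N\times N$ matrices with, for adjacent cells, $A^\flat_{ij}=\frac{2\Omega_i|e_{ij}|}{|S_{ij}|}A_{ij}$ ($j\in N(i)$). On a three-dimensional simplicial mesh, for non-adjacent $C_j,C_k$ with a common neighbour $C_i$, $A^\flat_{jk}$ is defined by $A^\flat_{ij}+A^\flat_{jk}+A^\flat_{ki}=K_{ijk}\,\omega_{\mathrm{DEC}}(e)$, where $e$ is the primal edge common to $C_i,C_j,C_k$; $K_{ijk}=\frac83 s_{ijk}\frac{|S_e\cap C_i|}{|S_e|}$ with $S_e$ the Voronoi face dual to $e$ and $s_{ijk}=1$ if the triplet $C_i,C_j,C_k$ is positively oriented around $e$ (turns clockwise when viewed along the oriented edge), $-1$ otherwise; and $\omega_{\mathrm{DEC}}(e)=\sum 2\Omega_i\frac{|e_{ij}|}{|S_{ij}|}A_{ij}s_{ij}$, summed over the faces $S_{ij}$ containing $e$, each counted once (the summand is symmetric in $i,j$), with $s_{ij}=1$ if $C_i,C_j$ are positively oriented around $e$ and $-1$ otherwise. All other entries vanish. On a two-dimensional Cartesian grid of size $h$, adjacent values are $2h^2A_{ij}$ and $A^\flat_{ij}=h^2\sum_{k\in N(i)\cap N(j)}(A_{ik}+A_{kj})$ for $i\notin N(j)$. Variations. A variation $\delta q$ of $q(t)$ with $\delta q\in S_q$ is encoded by $B=-\delta q\,q^{-1}\in\mathcal{S}$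 and induces $\delta A=\dot B+[A,B]$. The discrete $L^2$ inner product is symmetric by definition (that is, $\langle\!\langle [B,C]^\flat,A\rangle\!\rangle:=\langle\!\langle A^\flat,[B,C]\rangle\!\rangle$ for $A,B,C\in\mathcal{S}$), so $\delta\mathcal{L}_h(A)=\langle\!\langle A^\flat,\delta A\rangle\!\rangle$. The Lagrange--d'Alembert principle means that $A(t)\in\mathcal{S}$ for all $t$ and $\int_0^1\delta\mathcal{L}_h(A)\,dt=0$ for all smooth variations with $\delta q\in S_q$ vanishing at $t=0,1$. *)

theory Defs
  imports "HOL-Analysis.Analysis"
begin

section \<open>Meshes\<close>

text \<open>
  A mesh is a family \<open>C\<close> of cells, indexed by a finite type \<open>'n\<close> (so that
  \<open>N = CARD('n)\<close>), in a Euclidean space \<open>'a\<close>.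
\<close>

definition mesh_vertices :: "('n \<Rightarrow> 'a::euclidean_space set) \<Rightarrow> 'a set" where
  "mesh_vertices C = {v. \<exists>i. v extreme_point_of (C i)}"

definition simplicial_mesh :: "('n::finite \<Rightarrow> 'a::euclidean_space set) \<Rightarrow> bool" where
  "simplicial_mesh C \<longleftrightarrow>
     inj C \<and> triangulation (range C) \<and> (\<forall>i. int DIM('a) simplex (C i))"

text \<open>
  The grid planes orthogonal to the axis \<open>b\<close> have \<open>b\<close>-coordinates \<open>g b m\<close>, \<open>m \<in> \<int>\<close>, and
  \<open>z i\<close> is the integer position of the cell \<open>C i\<close>.  The spacing may vary; the grids of
  uniform size \<open>h\<close> are singled out by \<open>cartesian_grid\<close>.
\<close>

definition grid_cell :: "('a::euclidean_space \<Rightarrow> int \<Rightarrow> real) \<Rightarrow> ('a \<Rightarrow> int) \<Rightarrow> 'a set" where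
  "grid_cell g z = cbox (\<Sum>b\<in>Basis. g b (z b) *\<^sub>R b) (\<Sum>b\<in>Basis. g b (z b + 1) *\<^sub>R b)"

definition cartesian_mesh :: "('n::finite \<Rightarrow> 'a::euclidean_space set) \<Rightarrow> bool" where
  "cartesian_mesh C \<longleftrightarrow>
     inj C \<and> (\<exists>g z. (\<forall>b\<in>Basis. strict_mono (g b)) \<and> (\<forall>i. C i = grid_cell g (z i)))"

definition cartesian_grid :: "real \<Rightarrow> ('n::finite \<Rightarrow> 'a::euclidean_space set) \<Rightarrow> bool" where
  "cartesian_grid h C \<longleftrightarrow>
     0 < h \<and> inj C \<and>
     (\<exists>c z. \<forall>i. C i = grid_cell (\<lambda>b m. c \<bullet> b + h * of_int m) (z i))"

definition circumcenter :: "'a::euclidean_space set \<Rightarrow> 'a" where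
  "circumcenter K = (THE c. \<exists>r. \<forall>v. v extreme_point_of K \<longrightarrow> dist c v = r)"

definition delaunay :: "('n \<Rightarrow> 'a::euclidean_space set) \<Rightarrow> bool" where
  "delaunay C \<longleftrightarrow>
     (\<forall>i u. u extreme_point_of (C i) \<longrightarrow>
        (\<forall>v\<in>mesh_vertices C. dist (circumcenter (C i)) u \<le> dist (circumcenter (C i)) v))"

definition neighbours :: "('n \<Rightarrow> 'a::euclidean_space set) \<Rightarrow> 'n \<Rightarrow> 'n set" where
  "neighbours C i = {j. (C i \<inter> C j) facet_of (C i) \<and> (C i \<inter> C j) facet_of (C j)}"

definition vol :: "('n \<Rightarrow> 'a::euclidean_space set) \<Rightarrow> 'n \<Rightarrow> real" where
  "vol C i = measure lebesgue (C i)"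

text \<open>
  The codimension-one measure of a set contained in a hyperplane, as the volume of the right
  prism of unit height over it (length of a segment in the plane, area of a planar set in
  space).
\<close>

definition area :: "'a::euclidean_space set \<Rightarrow> real" where
  "area K =
     (let n = (SOME n. norm n = 1 \<and> (\<forall>x\<in>K. \<forall>y\<in>K. n \<bullet> (x - y) = 0))
      in measure lebesgue {x + s *\<^sub>R n | x s. x \<in> K \<and> 0 \<le> s \<and> s \<le> 1})"

definition face_area :: "('n \<Rightarrow> 'a::euclidean_space set) \<Rightarrow> 'n \<Rightarrow> 'n \<Rightarrow> real" where
  "face_area C i j = area (C i \<inter> C j)"

definition dual_length :: "('n \<Rightarrow> 'a::euclidean_space set) \<Rightarrow> 'n \<Rightarrow> 'n \<Rightarrow> real" where
  "dual_length C i j = dist (circumcenter (C i)) (circumcenter (C j))"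

text \<open>
  Of the shape-quality requirement, only the nondegeneracy of the dual edges is imposed.
\<close>

definition well_shaped :: "('n \<Rightarrow> 'a::euclidean_space set) \<Rightarrow> bool" where
  "well_shaped C \<longleftrightarrow> (\<forall>i. \<forall>j\<in>neighbours C i. 0 < dual_length C i j)"

definition mesh :: "('n::finite \<Rightarrow> 'a::euclidean_space set) \<Rightarrow> bool" where
  "mesh C \<longleftrightarrow> (simplicial_mesh C \<or> cartesian_mesh C) \<and> delaunay C \<and> well_shaped C"


section \<open>The group of discrete volume-preserving diffeomorphisms\<close>

definition Omega :: "('n::finite \<Rightarrow> 'a::euclidean_space set) \<Rightarrow> real^'n^'n" where
  "Omega C = (\<chi> i j. if i = j then vol C i else 0)"

definition diff_group :: "('n::finite \<Rightarrow> 'a::euclidean_space set) \<Rightarrow> (real^'n^'n) set" where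
  "diff_group C =
     {q. det q = 1 \<and> transpose q ** Omega C ** q = Omega C \<and> (\<forall>i. (\<Sum>j\<in>UNIV. q$i$j) = 1)}"

definition diff_algebra :: "('n::finite \<Rightarrow> 'a::euclidean_space set) \<Rightarrow> (real^'n^'n) set" where
  "diff_algebra C =
     {A. transpose A ** Omega C + Omega C ** A = 0 \<and> (\<forall>i. (\<Sum>j\<in>UNIV. A$i$j) = 0)}"

definition sparse :: "('n::finite \<Rightarrow> 'a::euclidean_space set) \<Rightarrow> (real^'n^'n) set" where
  "sparse C = {A \<in> diff_algebra C. \<forall>i j. A$i$j \<noteq> 0 \<longrightarrow> j \<in> neighbours C i}"

text \<open>The tangent space at \<open>q\<close> is the right translate of the Lie algebra.\<close>

definition tangent :: "('n::finite \<Rightarrow> 'a::euclidean_space set) \<Rightarrow> real^'n^'n \<Rightarrow> (real^'n^'n) set" where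
  "tangent C q = {Y ** q | Y. Y \<in> diff_algebra C}"

definition sparse_tangent ::
  "('n::finite \<Rightarrow> 'a::euclidean_space set) \<Rightarrow> real^'n^'n \<Rightarrow> (real^'n^'n) set" where
  "sparse_tangent C q = {X \<in> tangent C q. X ** matrix_inv q \<in> sparse C}"


section \<open>Discrete forms\<close>

definition commutator :: "real^'n^'n \<Rightarrow> real^'n^'n \<Rightarrow> real^'n^'n" where
  "commutator X Y = X ** Y - Y ** X"

definition one_form :: "real^'n^'n \<Rightarrow> bool" where
  "one_form F \<longleftrightarrow> (\<forall>i j. F$i$j = - F$j$i)"

definition d0 :: "real^'n \<Rightarrow> real^'n^'n" where
  "d0 f = (\<chi> i j. f$j - f$i)"

definition d1 :: "real^'n^'n \<Rightarrow> real^'n^'n^'n" where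
  "d1 F = (\<chi> i j k. F$i$j + F$j$k + F$k$i)"

definition contract1 :: "real^'n^'n \<Rightarrow> real^'n^'n \<Rightarrow> real^'n" where
  "contract1 A F = (\<chi> i. (A ** transpose F)$i$i)"

definition contract2 :: "real^'n^'n \<Rightarrow> real^'n^'n^'n \<Rightarrow> real^'n^'n" where
  "contract2 A G = (\<chi> i j. \<Sum>k\<in>UNIV. G$i$k$j * A$i$k - G$j$k$i * A$j$k)"

definition lie_derivative :: "real^'n^'n \<Rightarrow> real^'n^'n \<Rightarrow> real^'n^'n" where
  "lie_derivative A F = contract2 A (d1 F) + d0 (contract1 A F)"

definition pairing ::
  "('n::finite \<Rightarrow> 'a::euclidean_space set) \<Rightarrow> real^'n^'n \<Rightarrow> real^'n^'n \<Rightarrow> real" where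
  "pairing C F X = trace (Omega C ** X ** transpose F)"


section \<open>The flat operator\<close>

definition flat_adjacent ::
  "('n::finite \<Rightarrow> 'a::euclidean_space set) \<Rightarrow> real^'n^'n \<Rightarrow> 'n \<Rightarrow> 'n \<Rightarrow> real" where
  "flat_adjacent C A i j = 2 * vol C i * dual_length C i j / face_area C i j * A$i$j"

text \<open>
  The next definitions concern the edge with endpoints \<open>a\<close>, \<open>b\<close>, oriented from \<open>a\<close> to \<open>b\<close>, of a
  three-dimensional simplicial mesh; \<open>T\<close> is an isometric identification of the ambient space
  with \<open>real^3\<close>, used only for the cross product.

  Let \<open>x\<close> be a point of the common face off the edge and \<open>y\<close> a point of \<open>C j\<close> off that face.
  Passing from \<open>C i\<close> to \<open>C j\<close> across the face is a clockwise turn for an observer looking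
  along \<open>b - a\<close> iff \<open>b - a\<close>, \<open>x - a\<close>, \<open>y - a\<close> is a right-handed frame.  The triple product
  vanishes for the other \<open>x\<close>, \<open>y\<close>, and otherwise its sign does not depend on \<open>x\<close>, \<open>y\<close>.
\<close>

definition positive_pair ::
  "('a::euclidean_space \<Rightarrow> real^3) \<Rightarrow> ('n \<Rightarrow> 'a set) \<Rightarrow> 'a \<Rightarrow> 'a \<Rightarrow> 'n \<Rightarrow> 'n \<Rightarrow> bool" where
  "positive_pair T C a b i j \<longleftrightarrow>
     (\<exists>x\<in>C i \<inter> C j. \<exists>y\<in>C j. 0 < T (b - a) \<bullet> cross3 (T (x - a)) (T (y - a)))"

definition pair_sign ::
  "('a::euclidean_space \<Rightarrow> real^3) \<Rightarrow> ('n \<Rightarrow> 'a set) \<Rightarrow> 'a \<Rightarrow> 'a \<Rightarrow> 'n \<Rightarrow> 'n \<Rightarrow> real" where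
  "pair_sign T C a b i j = (if positive_pair T C a b i j then 1 else -1)"

text \<open>
  Here \<open>C i\<close> is adjacent to \<open>C j\<close> and \<open>C k\<close>, so that the cyclic order \<open>i, j, k\<close> around the edge
  is positive iff one turns positively from \<open>C k\<close> to \<open>C i\<close> and from \<open>C i\<close> to \<open>C j\<close>.
\<close>

definition triple_sign ::
  "('a::euclidean_space \<Rightarrow> real^3) \<Rightarrow> ('n \<Rightarrow> 'a set) \<Rightarrow> 'a \<Rightarrow> 'a \<Rightarrow> 'n \<Rightarrow> 'n \<Rightarrow> 'n \<Rightarrow> real" where
  "triple_sign T C a b i j k =
     (if positive_pair T C a b i j \<and> positive_pair T C a b k i then 1 else -1)"

definition voronoi_face :: "('n \<Rightarrow> 'a::euclidean_space set) \<Rightarrow> 'a \<Rightarrow> 'a \<Rightarrow> 'a set" where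
  "voronoi_face C a b =
     {x \<in> (\<Union>i. C i). dist x a = dist x b \<and> (\<forall>v\<in>mesh_vertices C. dist x a \<le> dist x v)}"

definition flat_coeff ::
  "('a::euclidean_space \<Rightarrow> real^3) \<Rightarrow> ('n \<Rightarrow> 'a set) \<Rightarrow> 'a \<Rightarrow> 'a \<Rightarrow> 'n \<Rightarrow> 'n \<Rightarrow> 'n \<Rightarrow> real" where
  "flat_coeff T C a b i j k =
     8 / 3 * triple_sign T C a b i j k
       * (area (voronoi_face C a b \<inter> C i) / area (voronoi_face C a b))"

text \<open>
  The sum over faces is half the sum over ordered pairs of adjacent cells, the summand being
  symmetric.
\<close>

definition omega_dec ::
  "('a::euclidean_space \<Rightarrow> real^3) \<Rightarrow> ('n::finite \<Rightarrow> 'a set) \<Rightarrow> 'a \<Rightarrow> 'a \<Rightarrow> real^'n^'n \<Rightarrow> real" where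
  "omega_dec T C a b A =
     (\<Sum>i\<in>UNIV. \<Sum>j | j \<in> neighbours C i \<and> closed_segment a b \<subseteq> C i \<inter> C j.
        flat_adjacent C A i j * pair_sign T C a b i j) / 2"

text \<open>
  The values of the flat operator on pairs of non-adjacent cells of a three-dimensional
  simplicial mesh.  Two such cells may have several common neighbours, giving incompatible
  values (for example around an interior edge with four cells); hence the formula is required
  for one common neighbour, chosen independently of \<open>A\<close>.  The orientations of the edge and of
  space are immaterial: reversing either one changes the sign of both factors on the right.
\<close>

definition flat_simplicial_3d ::
  "('n::finite \<Rightarrow> 'a::euclidean_space set) \<Rightarrow> (real^'n^'n \<Rightarrow> real^'n^'n) \<Rightarrow> bool" where
  "flat_simplicial_3d C flat \<longleftrightarrow>
     (\<forall>j k. j \<noteq> k \<and> k \<notin> neighbours C j \<longrightarrow>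
        (if neighbours C j \<inter> neighbours C k = {}
         then \<forall>A\<in>sparse C. flat A $ j $ k = 0
         else \<exists>i\<in>neighbours C j \<inter> neighbours C k.
           \<forall>T::'a \<Rightarrow> real^3. \<forall>a b.
             linear T \<and> (\<forall>x. norm (T x) = norm x) \<and> closed_segment a b = C i \<inter> C j \<inter> C k \<longrightarrow>
             (\<forall>A\<in>sparse C. flat A $ i $ j + flat A $ j $ k + flat A $ k $ i
                = flat_coeff T C a b i j k * omega_dec T C a b A)))"

definition flat_cartesian_2d ::
  "real \<Rightarrow> ('n::finite \<Rightarrow> 'a::euclidean_space set) \<Rightarrow> (real^'n^'n \<Rightarrow> real^'n^'n) \<Rightarrow> bool" where
  "flat_cartesian_2d h C flat \<longleftrightarrow>
     (\<forall>A\<in>sparse C. \<forall>i j.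
        flat A $ i $ j =
          (if j \<in> neighbours C i then 2 * h\<^sup>2 * A$i$j
           else h\<^sup>2 * (\<Sum>k\<in>neighbours C i \<inter> neighbours C j. A$i$k + A$k$j)))"

text \<open>
  The flat operator proper is the restriction of \<open>flat\<close> to \<open>sparse C\<close>.  Its values
  elsewhere are needed only for variations, which leave \<open>sparse C\<close> through commutators; there
  the last clause is the convention that the discrete inner product is symmetric.  A linear
  map on \<open>sparse C\<close> with the listed values always extends to a linear map satisfying this
  clause.
\<close>

definition flat_operator ::
  "('n::finite \<Rightarrow> 'a::euclidean_space set) \<Rightarrow> (real^'n^'n \<Rightarrow> real^'n^'n) \<Rightarrow> bool" where
  "flat_operator C flat \<longleftrightarrow>
     linear flat \<and>
     (\<forall>A\<in>sparse C. one_form (flat A)) \<and>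
     (\<forall>A\<in>sparse C. \<forall>i. \<forall>j\<in>neighbours C i. flat A $ i $ j = flat_adjacent C A i j) \<and>
     (DIM('a) = 3 \<and> simplicial_mesh C \<longrightarrow> flat_simplicial_3d C flat) \<and>
     (\<forall>h. DIM('a) = 2 \<and> cartesian_grid h C \<longrightarrow> flat_cartesian_2d h C flat) \<and>
     (\<forall>A\<in>sparse C. \<forall>X\<in>sparse C. \<forall>Y\<in>sparse C.
        pairing C (flat (commutator X Y)) A = pairing C (flat A) (commutator X Y))"


section \<open>The Lagrange--d'Alembert principle\<close>

definition smooth01 :: "(real \<Rightarrow> 'b::real_normed_vector) \<Rightarrow> bool" where
  "smooth01 f \<longleftrightarrow>
     (\<exists>D :: nat \<Rightarrow> real \<Rightarrow> 'b. (\<forall>t\<in>{0..1}. D 0 t = f t) \<and>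
        (\<forall>k. \<forall>t\<in>{0..1}. (D k has_vector_derivative D (Suc k) t) (at t within {0..1})))"

definition ddt :: "(real \<Rightarrow> 'b::real_normed_vector) \<Rightarrow> real \<Rightarrow> 'b" where
  "ddt f t = vector_derivative f (at t within {0..1})"

definition velocity :: "(real \<Rightarrow> real^'n^'n) \<Rightarrow> real \<Rightarrow> real^'n^'n" where
  "velocity q t = - (ddt q t ** matrix_inv (q t))"

definition lagrangian ::
  "('n::finite \<Rightarrow> 'a::euclidean_space set) \<Rightarrow> (real^'n^'n \<Rightarrow> real^'n^'n) \<Rightarrow> real^'n^'n \<Rightarrow> real" where
  "lagrangian C flat A = 1 / 2 * pairing C (flat A) A"

definition encoded :: "(real \<Rightarrow> real^'n^'n) \<Rightarrow> (real \<Rightarrow> real^'n^'n) \<Rightarrow> real \<Rightarrow> real^'n^'n" where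
  "encoded q dq t = - (dq t ** matrix_inv (q t))"

definition velocity_variation ::
  "(real \<Rightarrow> real^'n^'n) \<Rightarrow> (real \<Rightarrow> real^'n^'n) \<Rightarrow> real \<Rightarrow> real^'n^'n" where
  "velocity_variation q dq t =
     ddt (encoded q dq) t + commutator (velocity q t) (encoded q dq t)"

definition lagrangian_variation ::
  "('n::finite \<Rightarrow> 'a::euclidean_space set) \<Rightarrow> (real^'n^'n \<Rightarrow> real^'n^'n) \<Rightarrow>
     (real \<Rightarrow> real^'n^'n) \<Rightarrow> (real \<Rightarrow> real^'n^'n) \<Rightarrow> real \<Rightarrow> real" where
  "lagrangian_variation C flat q dq t =
     deriv (\<lambda>\<epsilon>. lagrangian C flat (velocity q t + \<epsilon> *\<^sub>R velocity_variation q dq t)) 0"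

definition lagrange_dalembert ::
  "('n::finite \<Rightarrow> 'a::euclidean_space set) \<Rightarrow> (real^'n^'n \<Rightarrow> real^'n^'n) \<Rightarrow>
     (real \<Rightarrow> real^'n^'n) \<Rightarrow> bool" where
  "lagrange_dalembert C flat q \<longleftrightarrow>
     (\<forall>t\<in>{0..1}. velocity q t \<in> sparse C) \<and>
     (\<forall>dq. smooth01 dq \<and> (\<forall>t\<in>{0..1}. dq t \<in> sparse_tangent C (q t)) \<and> dq 0 = 0 \<and> dq 1 = 0 \<longrightarrow>
        integral {0..1} (lagrangian_variation C flat q dq) = 0)"

end

theory Submission
  imports Defs
begin

text \<open>
  Testing the principle with variations \<open>B t = \<phi> t X\<close>, \<open>X\<close> sparse, gives
  \<open>\<langle>A\<^sup>\<flat>, [A, X]\<rangle> = \<langle>(dA/dt)\<^sup>\<flat>, X\<rangle>\<close> by the fundamental lemma of the calculus of variations, and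
  \<open>\<Omega>\<close>-antisymmetry of \<open>A\<close> turns the left side into \<open>- \<langle>L\<^sub>A A\<^sup>\<flat>, X\<rangle>\<close>.  So
  \<open>(dA/dt)\<^sup>\<flat> + L\<^sub>A A\<^sup>\<flat>\<close> annihilates the sparse fields, and on pairs of neighbours the
  1-forms annihilating them are the gradients.  The second form of the equation is the first one
  divided by the positive weight \<open>2 \<Omega>\<^sub>i |e\<^sub>i\<^sub>j| / |S\<^sub>i\<^sub>j|\<close>, because \<open>[A, F \<Omega>] = (L\<^sub>A F) \<Omega>\<close>.
\<close>

section \<open>Positivity of the mesh quantities\<close>

text \<open>Full affine dimension excludes containment in a hyperplane, so the interior is nonempty;
  a convex set with nonempty interior is not negligible.\<close>

lemma measure_convex_pos:
  fixes K :: "'a::euclidean_space set"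
  assumes "compact K" "convex K" "aff_dim K = DIM('a)"
  shows "0 < measure lebesgue K"
proof -
  have "interior K \<noteq> {}"
  proof
    assume "interior K = {}"
    with assms obtain a b where "a \<noteq> 0" "K \<subseteq> {x. a \<bullet> x = b}"
      using empty_interior_subset_hyperplane by metis
    then have "aff_dim K \<le> DIM('a) - 1"
      by (metis aff_dim_subset aff_dim_hyperplane)
    with assms show False by simp
  qed
  then have "measure lebesgue K \<noteq> 0"
    using assms negligible_convex_interior negligible_iff_measure0 lmeasurable_compact by blast
  then show ?thesis
    by (simp add: zero_less_measure_iff)
qed

text \<open>\<open>area\<close> is the volume of the unit prism \<open>P\<close> over
  \<open>K\<close>, and \<open>P\<close> is compact, convex and of full dimension.\<close>

lemma area_pos:
  fixes K :: "'a::euclidean_space set"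
  assumes "compact K" "convex K" "K \<noteq> {}" and dim: "aff_dim K = int DIM('a) - 1"
  shows "0 < area K"
proof -
  define n where "n = (SOME n. norm n = 1 \<and> (\<forall>x\<in>K. \<forall>y\<in>K. n \<bullet> (x - y) = 0))"
  define P where "P = {x + s *\<^sub>R n | x s. x \<in> K \<and> 0 \<le> s \<and> s \<le> 1}"
  obtain a b where ab: "a \<noteq> 0" "K \<subseteq> {x. a \<bullet> x = b}"
    using aff_lowdim_subset_hyperplane[of K] dim by auto
  \<comment> \<open>A unit normal exists, so the \<open>SOME\<close> in \<open>area\<close> really
    picks one.\<close>
  have "norm (sgn a) = 1 \<and> (\<forall>x\<in>K. \<forall>y\<in>K. sgn a \<bullet> (x - y) = 0)"
    using ab by (auto simp: norm_sgn sgn_div_norm inner_diff_right subset_iff)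
  then have n: "norm n = 1 \<and> (\<forall>x\<in>K. \<forall>y\<in>K. n \<bullet> (x - y) = 0)"
    unfolding n_def by (rule someI)
  have P_eq: "P = (\<lambda>(x, s). x + s *\<^sub>R n) ` (K \<times> {0..1})"
  proof (intro subset_antisym subsetI)
    fix y assume "y \<in> P"
    then obtain x s where "y = x + s *\<^sub>R n" "(x, s) \<in> K \<times> {0..1}"
      unfolding P_def by auto
    then show "y \<in> (\<lambda>(x, s). x + s *\<^sub>R n) ` (K \<times> {0..1})"
      by (intro image_eqI[of _ _ "(x, s)"]) simp_all
  next
    fix y assume "y \<in> (\<lambda>(x, s). x + s *\<^sub>R n) ` (K \<times> {0..1})"
    then obtain x s where "y = x + s *\<^sub>R n" "x \<in> K" "0 \<le> s" "s \<le> 1" by auto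
    then show "y \<in> P" unfolding P_def by blast
  qed
  have "compact P" unfolding P_eq
    by (intro compact_continuous_image compact_Times assms compact_Icc)
      (auto simp: case_prod_unfold intro!: continuous_intros)
  moreover have "linear (\<lambda>(x, s). x + s *\<^sub>R n)"
    by (auto simp: linear_iff algebra_simps)
  then have "convex P" unfolding P_eq
    by (intro convex_linear_image convex_Times assms) auto
  moreover have "aff_dim P = DIM('a)"
  proof -
    obtain x0 where x0: "x0 \<in> K" using assms by blast
    \<comment> \<open>The base lies in one hyperplane and the top point \<open>x0 + n\<close> off
      it, so passing from \<open>K\<close> to \<open>P\<close> raises the affine dimension to the
      maximum.\<close>
    have "K \<subseteq> {x. n \<bullet> x = n \<bullet> x0}"
    proof
      fix x assume "x \<in> K"
      with n x0 have "n \<bullet> (x - x0) = 0" by blast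
      then show "x \<in> {x. n \<bullet> x = n \<bullet> x0}" by (simp add: inner_diff_right)
    qed
    then have "affine hull K \<subseteq> {x. n \<bullet> x = n \<bullet> x0}"
      by (intro hull_minimal affine_hyperplane)
    then have "x0 + n \<notin> affine hull K"
      using n by (auto simp: inner_add_right dot_square_norm)
    moreover have "x0 + n \<in> P"
      unfolding P_eq using x0 by (intro image_eqI[of _ _ "(x0, 1)"]) auto
    moreover have "K \<subseteq> P"
    proof
      fix x assume "x \<in> K"
      then show "x \<in> P"
        unfolding P_eq by (intro image_eqI[of _ _ "(x, 0)"]) simp_all
    qed
    ultimately have "affine hull K \<subset> affine hull P"
      using hull_mono[of K P affine] hull_inc[of "x0 + n" P affine] by (simp add: psubset_eq) metis
    from aff_dim_psubset[OF this] show ?thesis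
      using dim aff_dim_le_DIM[of P] by linarith
  qed
  ultimately have "0 < measure lebesgue P" by (rule measure_convex_pos)
  then show ?thesis by (simp add: area_def Let_def n_def P_def)
qed

lemma mesh_cell:
  fixes C :: "'n::finite \<Rightarrow> 'a::euclidean_space set"
  assumes "mesh C"
  shows "compact (C i)" "convex (C i)" "aff_dim (C i) = DIM('a)"
proof -
  have "compact (C i) \<and> convex (C i) \<and> aff_dim (C i) = DIM('a)"
  proof (cases "simplicial_mesh C")
    case True
    then have "int DIM('a) simplex C i" by (simp add: simplicial_mesh_def)
    then show ?thesis
      by (simp add: compact_simplex convex_simplex aff_dim_simplex)
  next
    case False
    then obtain g z where g: "\<forall>b\<in>Basis. strict_mono (g b)" and C: "\<And>i. C i = grid_cell g (z i)"
      using assms unfolding mesh_def cartesian_mesh_def by blast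
    let ?l = "\<Sum>b\<in>Basis. g b (z i b) *\<^sub>R b" and ?u = "\<Sum>b\<in>Basis. g b (z i b + 1) *\<^sub>R b"
    \<comment> \<open>Strictly increasing grid coordinates give positive side lengths.\<close>
    have "box ?l ?u \<noteq> {}"
      using g by (auto simp: box_ne_empty strict_mono_def)
    then have "interior (C i) \<noteq> {}"
      by (simp add: C grid_cell_def interior_cbox)
    then have "aff_dim (C i) = DIM('a)"
      by (rule aff_dim_nonempty_interior)
    then show ?thesis by (simp add: C grid_cell_def)
  qed
  then show "compact (C i)" "convex (C i)" "aff_dim (C i) = DIM('a)" by auto
qed

lemma vol_pos: "mesh C \<Longrightarrow> 0 < vol C i"
  by (simp add: vol_def measure_convex_pos mesh_cell)

text \<open>A facet is nonempty and its affine dimension is one less than that of its cell, as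
  \<open>area_pos\<close> requires.\<close>

lemma face_area_pos: "mesh C \<Longrightarrow> j \<in> neighbours C i \<Longrightarrow> 0 < face_area C i j"
  unfolding face_area_def
  by (rule area_pos)
    (auto simp: mesh_cell compact_Int convex_Int neighbours_def facet_of_def)

lemma dual_length_pos: "mesh C \<Longrightarrow> j \<in> neighbours C i \<Longrightarrow> 0 < dual_length C i j"
  by (auto simp: mesh_def well_shaped_def)

lemma neighbours_sym: "j \<in> neighbours C i \<longleftrightarrow> i \<in> neighbours C j"
  by (auto simp: neighbours_def Int_commute)

section \<open>Smooth curves\<close>

text \<open>Dependent choice inside a class closed under differentiation yields the infinite
  sequence of derivatives in \<open>smooth01\<close>. The closure lemmas for linear maps, products
  and sums each choose such a class.\<close>

lemma smooth01_coinduct: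
  fixes f :: "real \<Rightarrow> 'b::real_normed_vector"
  assumes "P f"
    and step: "\<And>f. P f \<Longrightarrow>
      \<exists>f'. P f' \<and> (\<forall>t\<in>{0..1}. (f has_vector_derivative f' t) (at t within {0..1}))"
  shows "smooth01 f"
proof -
  let ?Q = "\<lambda>g g' :: real \<Rightarrow> 'b.
    \<forall>t\<in>{0..1}. (g has_vector_derivative g' t) (at t within {0..1})"
  \<comment> \<open>The clause for \<open>k = 0\<close> makes the sequence start at \<open>f\<close>
    rather than at an arbitrary member of the class.\<close>
  have "\<exists>D. \<forall>k. (P (D k) \<and> (k = 0 \<longrightarrow> D k = f)) \<and> ?Q (D k) (D (Suc k))"
  proof (rule dependent_nat_choice)
    show "\<exists>g. P g \<and> ((0::nat) = 0 \<longrightarrow> g = f)"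
      using assms(1) by (intro exI[of _ f]) simp
  next
    fix g :: "real \<Rightarrow> 'b" and k :: nat
    assume "P g \<and> (k = 0 \<longrightarrow> g = f)"
    then obtain g' where "P g'" "?Q g g'" using step[of g] by metis
    then show "\<exists>g'. (P g' \<and> (Suc k = 0 \<longrightarrow> g' = f)) \<and> ?Q g g'"
      by (intro exI[of _ g']) simp
  qed
  then obtain D where D: "\<And>k. (P (D k) \<and> (k = 0 \<longrightarrow> D k = f)) \<and> ?Q (D k) (D (Suc k))"
    by metis
  then have "D 0 = f" by simp
  then show ?thesis
    unfolding smooth01_def using D by (intro exI[of _ D]) simp
qed

lemma smooth01_has_ddt:
  fixes f :: "real \<Rightarrow> 'b::real_normed_vector"
  assumes "smooth01 f" "t \<in> {0..1}"
  shows "(f has_vector_derivative ddt f t) (at t within {0..1})"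
proof -
  obtain D :: "nat \<Rightarrow> real \<Rightarrow> 'b" where D: "\<forall>t\<in>{0..1}. D 0 t = f t"
     "\<forall>k. \<forall>t\<in>{0..1}. (D k has_vector_derivative D (Suc k) t) (at t within {0..1})"
    using assms unfolding smooth01_def by blast
  have "(f has_vector_derivative D 1 t) (at t within {0..1})"
    using D assms by (intro has_vector_derivative_transform[of t "{0..1}" f "D 0"]) auto
  then show ?thesis
    unfolding ddt_def by (metis differentiableI_vector vector_derivative_works)
qed

text \<open>The endpoints are limit points of the interval too, so the one-sided derivatives there
  are also unique.\<close>

lemma ddt_eqI:
  assumes "t \<in> {0..1}" "(f has_vector_derivative f') (at t within {0..1})"
  shows "ddt f t = f'"
  unfolding ddt_def using assms
  by (intro vector_derivative_within[OF _ assms(2)]) (simp add: trivial_limit_within islimpt_Icc)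

lemma smooth01_cong:
  assumes "smooth01 f" "\<And>t. t \<in> {0..1} \<Longrightarrow> f t = g t"
  shows "smooth01 g"
  using assms unfolding smooth01_def by metis

text \<open>Dropping the head of the derivative sequence of \<open>f\<close> leaves one for its
  derivative.\<close>

lemma smooth01_ddt:
  fixes f :: "real \<Rightarrow> 'b::real_normed_vector"
  assumes "smooth01 f"
  shows "smooth01 (ddt f)"
proof -
  obtain D :: "nat \<Rightarrow> real \<Rightarrow> 'b" where D: "\<forall>t\<in>{0..1}. D 0 t = f t"
     "\<forall>k. \<forall>t\<in>{0..1}. (D k has_vector_derivative D (Suc k) t) (at t within {0..1})"
    using assms unfolding smooth01_def by blast
  have "ddt f t = D 1 t" if "t \<in> {0..1}" for t
    using D that by (intro ddt_eqI has_vector_derivative_transform[of t "{0..1}" f "D 0"]) auto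
  moreover have "smooth01 (D 1)"
    unfolding smooth01_def using D by (intro exI[of _ "\<lambda>k. D (Suc k)"]) auto
  ultimately show ?thesis by (metis smooth01_cong)
qed

lemma smooth01_continuous_on: "smooth01 f \<Longrightarrow> continuous_on {0..1} f"
  unfolding continuous_on_eq_continuous_within
  by (intro ballI has_vector_derivative_continuous[OF smooth01_has_ddt])

lemma smooth01_bounded_linear:
  assumes "bounded_linear h" "smooth01 f"
  shows "smooth01 (\<lambda>t. h (f t))"
proof (rule smooth01_coinduct[of "\<lambda>k. \<exists>g. smooth01 g \<and> k = (\<lambda>t. h (g t))"])
  show "\<exists>g. smooth01 g \<and> (\<lambda>t. h (f t)) = (\<lambda>t. h (g t))"
    by (rule exI[of _ f]) (simp add: assms)
next
  fix k assume "\<exists>g. smooth01 g \<and> k = (\<lambda>t. h (g t))"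
  then obtain g where g: "smooth01 g" "k = (\<lambda>t. h (g t))" by (elim exE conjE)
  have "\<forall>t\<in>{0..1}. (k has_vector_derivative h (ddt g t)) (at t within {0..1})"
    unfolding g(2)
    by (intro ballI bounded_linear.has_vector_derivative[OF assms(1)] smooth01_has_ddt g(1))
  then show "\<exists>k'. (\<exists>g. smooth01 g \<and> k' = (\<lambda>t. h (g t))) \<and>
      (\<forall>t\<in>{0..1}. (k has_vector_derivative k' t) (at t within {0..1}))"
    by (intro exI[of _ "\<lambda>t. h (ddt g t)"] conjI exI[of _ "ddt g"] smooth01_ddt g refl)
qed

text \<open>By the Leibniz rule this class is closed under differentiation, unlike single products.\<close>

inductive sum_of_products :: "('a::real_normed_vector \<Rightarrow> 'b::real_normed_vector \<Rightarrow> 'c::real_normed_vector)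
    \<Rightarrow> (real \<Rightarrow> 'c) \<Rightarrow> bool" for m where
  product: "smooth01 f \<Longrightarrow> smooth01 g \<Longrightarrow> sum_of_products m (\<lambda>t. m (f t) (g t))"
| sum: "sum_of_products m h \<Longrightarrow> sum_of_products m k \<Longrightarrow> sum_of_products m (\<lambda>t. h t + k t)"

text \<open>Serves matrix products, the pairing, real products and scalar multiplication
  alike.\<close>

lemma smooth01_bounded_bilinear:
  assumes "bounded_bilinear m" "smooth01 f" "smooth01 g"
  shows "smooth01 (\<lambda>t. m (f t) (g t))"
proof (rule smooth01_coinduct[of "sum_of_products m"])
  show "sum_of_products m (\<lambda>t. m (f t) (g t))"
    using assms by (blast intro: sum_of_products.product)
next
  fix h assume "sum_of_products m h"
  then show "\<exists>h'. sum_of_products m h' \<and>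
      (\<forall>t\<in>{0..1}. (h has_vector_derivative h' t) (at t within {0..1}))"
  proof induction
    case (product f g)
    have "sum_of_products m (\<lambda>t. m (f t) (ddt g t) + m (ddt f t) (g t))"
      by (rule sum_of_products.sum;
          rule sum_of_products.product) (simp_all add: product smooth01_ddt)
    moreover have "\<forall>t\<in>{0..1}. ((\<lambda>t. m (f t) (g t)) has_vector_derivative
        m (f t) (ddt g t) + m (ddt f t) (g t)) (at t within {0..1})"
      by (intro ballI bounded_bilinear.has_vector_derivative[OF assms(1)]
          smooth01_has_ddt product)
    ultimately show ?case by (intro exI[of _ "\<lambda>t. m (f t) (ddt g t) + m (ddt f t) (g t)"] conjI)
  next
    case (sum h k)
    then obtain h' k' where "sum_of_products m h'" "sum_of_products m k'"
      and "\<forall>t\<in>{0..1}. (h has_vector_derivative h' t) (at t within {0..1})"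
      and "\<forall>t\<in>{0..1}. (k has_vector_derivative k' t) (at t within {0..1})"
      by (elim exE conjE)
    then show ?case
      by (intro exI[of _ "\<lambda>t. h' t + k' t"] conjI ballI has_vector_derivative_add
          sum_of_products.sum) simp_all
  qed
qed

lemma smooth01_add:
  assumes "smooth01 f" "smooth01 g"
  shows "smooth01 (\<lambda>t. f t + g t)"
proof (rule smooth01_coinduct[of "\<lambda>h. \<exists>f g. smooth01 f \<and> smooth01 g \<and> h = (\<lambda>t. f t + g t)"])
  show "\<exists>f' g'. smooth01 f' \<and> smooth01 g' \<and> (\<lambda>t. f t + g t) = (\<lambda>t. f' t + g' t)"
    by (intro exI[of _ f] exI[of _ g]) (simp add: assms)
next
  fix h :: "real \<Rightarrow> 'a" assume "\<exists>f g. smooth01 f \<and> smooth01 g \<and> h = (\<lambda>t. f t + g t)"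
  then obtain f g where fg: "smooth01 f" "smooth01 g" "h = (\<lambda>t. f t + g t)"
    by (elim exE conjE)
  have "\<forall>t\<in>{0..1}. (h has_vector_derivative ddt f t + ddt g t) (at t within {0..1})"
    unfolding fg(3) by (intro ballI has_vector_derivative_add smooth01_has_ddt fg)
  then show "\<exists>h'. (\<exists>f g. smooth01 f \<and> smooth01 g \<and> h' = (\<lambda>t. f t + g t)) \<and>
      (\<forall>t\<in>{0..1}. (h has_vector_derivative h' t) (at t within {0..1}))"
    by (intro exI[of _ "\<lambda>t. ddt f t + ddt g t"] conjI exI[of _ "ddt f"] exI[of _ "ddt g"]
        smooth01_ddt fg refl)
qed

text \<open>Provides the smoothness of the cut-off t (1 - t) in the variations.\<close>

lemma smooth01_quadratic: "smooth01 (\<lambda>t::real. a + b * t + c * t * t)"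
proof (rule smooth01_coinduct[of "\<lambda>h. \<exists>a b c. h = (\<lambda>t. a + b * t + c * t * t)"])
  show "\<exists>a' b' c'. (\<lambda>t. a + b * t + c * t * t) = (\<lambda>t. a' + b' * t + c' * t * t)"
    by (intro exI[of _ a] exI[of _ b] exI[of _ c] refl)
next
  fix h :: "real \<Rightarrow> real" assume "\<exists>a b c. h = (\<lambda>t. a + b * t + c * t * t)"
  then obtain a b c where h: "h = (\<lambda>t. a + b * t + c * t * t)" by (elim exE)
  \<comment> \<open>The zero quadratic term keeps the derivative literally inside the class.\<close>
  have "\<forall>t\<in>{0..1}. (h has_vector_derivative b + (2 * c) * t + 0 * t * t) (at t within {0..1})"
    unfolding h by (auto intro!: derivative_eq_intros simp: algebra_simps
        simp flip: has_real_derivative_iff_has_vector_derivative)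
  then show "\<exists>h'. (\<exists>a b c. h' = (\<lambda>t. a + b * t + c * t * t)) \<and>
      (\<forall>t\<in>{0..1}. (h has_vector_derivative h' t) (at t within {0..1}))"
    by (intro exI[of _ "\<lambda>t. b + (2 * c) * t + 0 * t * t"] conjI
        exI[of _ b] exI[of _ "2 * c"] exI[of _ 0] refl)
qed

section \<open>Matrix algebra\<close>

lemma matrix_diff_ldistrib: "A ** (B - C) = A ** B - A ** (C :: 'a::ring_1^'n^'m)"
  by (simp add: matrix_matrix_mult_def vec_eq_iff right_diff_distrib sum_subtractf)

lemma matrix_diff_rdistrib: "(A - B) ** C = A ** C - B ** (C :: 'a::ring_1^'n^'m)"
  by (simp add: matrix_matrix_mult_def vec_eq_iff left_diff_distrib sum_subtractf)

lemma matrix_minus_left: "(- A) ** B = - (A ** (B :: 'a::ring_1^'n^'m))"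
  using matrix_diff_rdistrib[of 0 A B] by simp

lemma matrix_minus_right: "A ** (- B) = - (A ** (B :: 'a::ring_1^'n^'m))"
  using matrix_diff_ldistrib[of A 0 B] by simp

lemma transpose_add: "transpose (A + B) = transpose A + transpose (B :: 'a::ring_1^'n^'m)"
  by (simp add: transpose_def vec_eq_iff)

lemma matrix_add_rdistrib: "(A + B) ** C = A ** C + B ** (C :: 'a::ring_1^'n^'m)"
  using matrix_diff_rdistrib[of A "- B" C] by (simp add: matrix_minus_left)

lemma trace_minus: "trace (- A) = - trace (A :: 'a::comm_ring_1^'n^'n)"
  by (simp add: trace_def sum_negf)

lemma bounded_bilinear_matrix_mult:
  "bounded_bilinear ((**) :: real^'n^'m \<Rightarrow> real^'p^'n \<Rightarrow> real^'p^'m)"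
  unfolding bilinear_conv_bounded_bilinear[symmetric] bilinear_def linear_iff
  by (simp add: matrix_add_ldistrib matrix_add_rdistrib matrix_scalar_ac flip: scalar_matrix_assoc)

lemma bounded_linear_transpose: "bounded_linear (transpose :: real^'n^'m \<Rightarrow> real^'m^'n)"
  unfolding linear_conv_bounded_linear[symmetric] linear_iff
  by (simp add: transpose_add transpose_scalar)

lemma bounded_bilinear_commutator:
  "bounded_bilinear (commutator :: real^'n^'n \<Rightarrow> real^'n^'n \<Rightarrow> real^'n^'n)"
  unfolding bilinear_conv_bounded_bilinear[symmetric] bilinear_def linear_iff commutator_def
  by (simp add: matrix_add_ldistrib matrix_add_rdistrib matrix_scalar_ac
      scaleR_diff_right flip: scalar_matrix_assoc)

text \<open>A left inverse of a square matrix is two-sided, hence unique, so the choice in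
  \<open>matrix_inv\<close> is determined.\<close>

lemma matrix_inv_eqI:
  fixes A :: "real^'n^'n"
  assumes "B ** A = mat 1"
  shows "matrix_inv A = B" "A ** B = mat 1"
proof -
  show AB: "A ** B = mat 1" by (rule matrix_left_right_inverse[THEN iffD1, OF assms])
  with assms have "\<exists>B. A ** B = mat 1 \<and> B ** A = mat 1" by (intro exI[of _ B] conjI)
  then have "A ** matrix_inv A = mat 1 \<and> matrix_inv A ** A = mat 1"
    unfolding matrix_inv_def by (rule someI_ex)
  then show "matrix_inv A = B"
    by (metis assms matrix_mul_assoc matrix_mul_lid matrix_mul_rid)
qed

section \<open>The discrete algebra\<close>

lemma Omega_mult_left: "(Omega C ** X) $ i $ j = vol C i * X $ i $ j"
  by (simp add: Omega_def matrix_matrix_mult_def if_distrib if_distribR sum.delta' cong: if_cong)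

lemma Omega_mult_right: "(X ** Omega C) $ i $ j = X $ i $ j * vol C j"
  by (simp add: Omega_def matrix_matrix_mult_def if_distrib if_distribR sum.delta cong: if_cong)

text \<open>Makes bilinearity and orthogonal decomposition available for the pairing.\<close>

lemma pairing_inner: "pairing C F X = F \<bullet> (Omega C ** X)"
  unfolding pairing_def trace_def inner_vec_def
  by (simp add: matrix_matrix_mult_def[of "Omega C ** X"] transpose_def mult.commute)

lemma pairing_add_left: "pairing C (F + G) X = pairing C F X + pairing C G X"
  by (simp add: pairing_inner inner_add_left)

lemma pairing_add_right: "pairing C F (X + Y) = pairing C F X + pairing C F Y"
  by (simp add: pairing_inner inner_add_right matrix_add_ldistrib)

lemma pairing_scaleR_left: "pairing C (c *\<^sub>R F) X = c * pairing C F X"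
  by (simp add: pairing_inner)

lemma pairing_scaleR_right: "pairing C F (c *\<^sub>R X) = c * pairing C F X"
  by (simp add: pairing_inner matrix_scalar_ac flip: scalar_matrix_assoc)

section \<open>The Lie algebra, its sparse part and the group\<close>

lemma diff_algebra_iff:
  "A \<in> diff_algebra C \<longleftrightarrow>
    (\<forall>i j. vol C i * A $ i $ j + vol C j * A $ j $ i = 0) \<and> (\<forall>i. (\<Sum>j\<in>UNIV. A $ i $ j) = 0)"
proof -
  have "(transpose A ** Omega C + Omega C ** A) $ i $ j = vol C i * A $ i $ j + vol C j * A $ j $ i"
    for i j by (simp add: Omega_mult_left Omega_mult_right transpose_def)
  then have "transpose A ** Omega C + Omega C ** A = 0 \<longleftrightarrow>
      (\<forall>i j. vol C i * A $ i $ j + vol C j * A $ j $ i = 0)"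
    by (simp only: vec_eq_iff zero_index)
  then show ?thesis by (simp add: diff_algebra_def)
qed

lemma subspace_diff_algebra: "subspace (diff_algebra C)"
proof (rule subspaceI)
  show "0 \<in> diff_algebra C" by (simp add: diff_algebra_iff)
next
  fix A B assume AB: "A \<in> diff_algebra C" "B \<in> diff_algebra C"
  have "transpose (A + B) ** Omega C + Omega C ** (A + B)
      = (transpose A ** Omega C + Omega C ** A) + (transpose B ** Omega C + Omega C ** B)"
    by (simp add: transpose_add matrix_add_ldistrib matrix_add_rdistrib)
  with AB show "A + B \<in> diff_algebra C"
    by (simp add: diff_algebra_def sum.distrib)
next
  fix c A assume A: "A \<in> diff_algebra C"
  have "transpose (c *\<^sub>R A) ** Omega C + Omega C ** (c *\<^sub>R A)
      = c *\<^sub>R (transpose A ** Omega C + Omega C ** A)"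
    by (simp add: transpose_scalar matrix_scalar_ac scaleR_add_right flip: scalar_matrix_assoc)
  with A show "c *\<^sub>R A \<in> diff_algebra C"
    by (simp add: diff_algebra_def flip: sum_distrib_left)
qed

text \<open>Lets test fields be rescaled in time and keeps the time derivative of the velocity
  sparse.\<close>

lemma subspace_sparse:
  fixes C :: "'n::finite \<Rightarrow> 'a::euclidean_space set"
  shows "subspace (sparse C)"
proof -
  have "subspace {A :: real^'n^'n. \<forall>i j. A $ i $ j \<noteq> 0 \<longrightarrow> j \<in> neighbours C i}"
    by (rule subspaceI) (auto, metis add.right_neutral)
  moreover have "sparse C = diff_algebra C \<inter> {A. \<forall>i j. A $ i $ j \<noteq> 0 \<longrightarrow> j \<in> neighbours C i}"
    by (auto simp: sparse_def)
  ultimately show ?thesis by (simp add: subspace_inter subspace_diff_algebra)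
qed

text \<open>Multiplying the defining relation of the group by the inverse of Omega exhibits a left
  inverse. It is linear in \<open>q\<close>, so smoothness of the inverse comes from that of
  \<open>q\<close>.\<close>

lemma diff_group_inverse:
  assumes "mesh C" "q \<in> diff_group C"
  shows "matrix_inv q = (\<chi> i j. if i = j then inverse (vol C i) else 0) ** (transpose q ** Omega C)"
    and "matrix_inv q ** q = mat 1" and "q ** matrix_inv q = mat 1"
proof -
  let ?M = "\<chi> i j. if i = j then inverse (vol C i) else 0"
  have "?M ** Omega C = mat 1"
    using vol_pos[OF assms(1)]
    by (auto simp: vec_eq_iff Omega_mult_right mat_def less_imp_neq[THEN not_sym])
  then have inv: "(?M ** (transpose q ** Omega C)) ** q = mat 1"
    using assms(2) by (simp add: diff_group_def flip: matrix_mul_assoc)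
  show "matrix_inv q = ?M ** (transpose q ** Omega C)" by (rule matrix_inv_eqI(1)[OF inv])
  with inv matrix_inv_eqI(2)[OF inv]
  show "matrix_inv q ** q = mat 1" "q ** matrix_inv q = mat 1" by simp_all
qed

section \<open>The Lie derivative of a 1-form\<close>

lemma lie_derivative_eq:
  assumes "A \<in> diff_algebra C" "one_form F"
  shows "lie_derivative A F = A ** F + F ** transpose A"
proof -
  have F: "F $ i $ j = - F $ j $ i" for i j using assms(2) unfolding one_form_def by blast
  \<comment> \<open>In these terms the form does not depend on the summation index, so the null-row
    condition removes them.\<close>
  have row: "(\<Sum>k\<in>UNIV. A $ i $ k * F $ j $ i) = 0" "(\<Sum>k\<in>UNIV. A $ j $ k * F $ i $ j) = 0" for i j
    using assms(1) by (simp_all add: diff_algebra_iff flip: sum_distrib_right)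
  have "lie_derivative A F $ i $ j = (A ** F + F ** transpose A) $ i $ j" for i j
  proof -
    have "lie_derivative A F $ i $ j =
       (\<Sum>k\<in>UNIV. (F $ i $ k + F $ k $ j + F $ j $ i) * A $ i $ k
          - (F $ j $ k + F $ k $ i + F $ i $ j) * A $ j $ k
          + (A $ j $ k * F $ j $ k - A $ i $ k * F $ i $ k))"
      by (simp add: lie_derivative_def contract2_def contract1_def d1_def d0_def
          matrix_matrix_mult_def transpose_def sum.distrib sum_subtractf)
    \<comment> \<open>The products \<open>A $ i $ k * F $ i $ k\<close> and
      \<open>A $ j $ k * F $ j $ k\<close> from the contraction of \<open>d1 F\<close> cancel
      against the gradient of \<open>contract1 A F\<close>.\<close>
    also have "\<dots> = (\<Sum>k\<in>UNIV. (A $ i $ k * F $ k $ j + F $ i $ k * A $ j $ k)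
          + (A $ i $ k * F $ j $ i - A $ j $ k * F $ i $ j))"
      by (intro sum.cong refl) (simp add: F[of _ i] algebra_simps)
    also have "\<dots> = (\<Sum>k\<in>UNIV. A $ i $ k * F $ k $ j + F $ i $ k * A $ j $ k)"
      by (simp add: sum.distrib sum_subtractf row)
    finally show ?thesis
      by (simp add: matrix_matrix_mult_def transpose_def sum.distrib)
  qed
  then show ?thesis by (simp add: vec_eq_iff)
qed

lemma one_form_transpose: "one_form F \<longleftrightarrow> transpose F = - F"
  by (auto simp: one_form_def vec_eq_iff transpose_def)

text \<open>Transposition swaps the summands of \<open>A ** F + F ** transpose A\<close>, up to the
  sign contributed by \<open>F\<close>.\<close>

lemma one_form_lie_derivative:
  assumes "A \<in> diff_algebra C" "one_form F"
  shows "one_form (lie_derivative A F)"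
  using assms(2)
  by (simp add: one_form_transpose lie_derivative_eq[OF assms] transpose_add matrix_transpose_mul
      matrix_minus_left matrix_minus_right)

text \<open>Omega-antisymmetry turns \<open>F ** Omega C ** A\<close> into
  \<open>- (F ** transpose A ** Omega C)\<close>, so Omega factors out on the right and scales
  column \<open>j\<close> by \<open>vol C j\<close>.\<close>

lemma lie_derivative_commutator:
  assumes "A \<in> diff_algebra C" "one_form F"
  shows "commutator A (F ** Omega C) $ i $ j = vol C j * lie_derivative A F $ i $ j"
proof -
  have "F ** Omega C ** A = - (F ** transpose A ** Omega C)"
  proof -
    have "Omega C ** A = - (transpose A ** Omega C)"
      using assms(1) by (simp add: diff_algebra_def eq_neg_iff_add_eq_0 add.commute)
    then show ?thesis by (simp add: matrix_minus_right flip: matrix_mul_assoc)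
  qed
  then have "commutator A (F ** Omega C) = lie_derivative A F ** Omega C"
    by (simp add: commutator_def lie_derivative_eq[OF assms] matrix_add_rdistrib matrix_mul_assoc)
  then show ?thesis by (simp add: Omega_mult_right)
qed

text \<open>Omega-antisymmetry trades \<open>Omega C ** A\<close> for
  \<open>- (transpose A ** Omega C)\<close>; cyclicity of the trace then moves
  \<open>transpose A\<close> behind \<open>F\<close>, where it forms the second summand of the Lie
  derivative.\<close>

lemma pairing_commutator:
  assumes "A \<in> diff_algebra C" "one_form F"
  shows "pairing C F (commutator A X) = - pairing C (lie_derivative A F) X"
proof -
  have OA: "Omega C ** A = - (transpose A ** Omega C)"
    using assms(1) by (simp add: diff_algebra_def eq_neg_iff_add_eq_0 add.commute)
  have F: "transpose F = - F" using assms(2) by (simp add: one_form_transpose)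
  have "trace (Omega C ** A ** X ** F) = - trace (transpose A ** (Omega C ** X ** F))"
    by (simp add: OA matrix_minus_left trace_minus matrix_mul_assoc)
  also have "\<dots> = - trace (Omega C ** X ** F ** transpose A)"
    by (subst trace_mul_sym) simp
  finally show ?thesis
    by (simp add: pairing_def commutator_def lie_derivative_eq[OF assms] F transpose_add
        matrix_transpose_mul matrix_diff_ldistrib matrix_diff_rdistrib matrix_add_ldistrib
        matrix_minus_left matrix_minus_right trace_minus trace_add trace_sub matrix_mul_assoc)
qed

text \<open>
  A masked 1-form splits orthogonally into a masked gradient and a remainder; orthogonality to
  all masked gradients makes the remainder null-row, so after dividing row \<open>i\<close> by \<open>vol C i\<close>
  it is itself a test field.
\<close>

lemma gradient_on_neighbours:
  fixes W :: "real^'n^'n"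
  assumes "mesh C" "one_form W"
    and ortho: "\<And>X. X \<in> sparse C \<Longrightarrow> pairing C W X = 0"
  shows "\<exists>p. \<forall>i. \<forall>j\<in>neighbours C i. W $ i $ j + d0 p $ i $ j = 0"
proof -
  define mask :: "real^'n^'n \<Rightarrow> real^'n^'n" where
    "mask F = (\<chi> i j. if j \<in> neighbours C i then F $ i $ j else 0)" for F
  define G where "G = range (\<lambda>p. mask (d0 p))"
  have "linear (\<lambda>p. mask (d0 p))"
    by (auto simp: linear_iff mask_def d0_def vec_eq_iff algebra_simps)
  then have spanG: "span G = G"
    unfolding G_def by (metis linear_subspace_image span_eq_iff subspace_UNIV)
  obtain y z where yz: "y \<in> span G" "\<And>w. w \<in> span G \<Longrightarrow> orthogonal z w" "mask W = y + z"
    using orthogonal_subspace_decomp_exists[of G "mask W"] by metis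
  then have "y \<in> G" by (simp only: spanG)
  then obtain p where p: "y = mask (d0 p)" unfolding G_def by auto
  have z: "z = mask (W - d0 p)"
  proof -
    have "mask (W - d0 p) = mask W - y" by (simp add: p mask_def vec_eq_iff)
    then show ?thesis by (simp add: yz(3))
  qed
  have W: "W $ i $ j = - W $ j $ i" for i j using assms(2) unfolding one_form_def by blast
  \<comment> \<open>The mask respects antisymmetry because the neighbour relation is
    symmetric.\<close>
  have anti: "z $ i $ j = - z $ j $ i" for i j
    using W[of i j] neighbours_sym[of j C i] by (simp add: z mask_def d0_def)
  have row: "(\<Sum>j\<in>UNIV. z $ k $ j) = 0" for k
  proof -
    \<comment> \<open>Testing with the gradient of the indicator of cell \<open>k\<close> gives the
      \<open>k\<close>-th column sum minus the \<open>k\<close>-th row sum, which is minus twice the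
      row sum by antisymmetry.\<close>
    have "0 = z \<bullet> mask (d0 (axis k 1))"
      using yz(2)[of "mask (d0 (axis k 1))"] unfolding spanG by (simp add: orthogonal_def G_def)
    also have "\<dots> = (\<Sum>i\<in>UNIV. \<Sum>j\<in>UNIV. z $ i $ j * (axis k 1 $ j - axis k 1 $ i))"
      unfolding inner_vec_def by (intro sum.cong refl) (auto simp: z mask_def d0_def)
    also have "\<dots> = (\<Sum>i\<in>UNIV. z $ i $ k) - (\<Sum>j\<in>UNIV. z $ k $ j)"
    proof -
      have "(\<Sum>j\<in>UNIV. z $ i $ j * (axis k 1 $ j - axis k 1 $ i))
          = z $ i $ k - (if i = k then \<Sum>j\<in>UNIV. z $ k $ j else 0)" for i
      proof -
        have "z $ i $ j * (axis k 1 $ j - axis k 1 $ i)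
            = (if j = k then z $ i $ j else 0) - (if i = k then z $ i $ j else 0)" for j
          by (simp add: axis_def)
        then show ?thesis by (simp add: sum_subtractf)
      qed
      then show ?thesis by (simp add: sum_subtractf)
    qed
    also have "\<dots> = - 2 * (\<Sum>j\<in>UNIV. z $ k $ j)"
      by (subst anti) (simp add: sum_negf)
    finally show ?thesis by simp
  qed
  define X where "X = (\<chi> i j. z $ i $ j / vol C i)"
  have vol: "vol C i \<noteq> 0" for i using vol_pos[OF assms(1), of i] by simp
  have OX: "Omega C ** X = z" by (simp add: vec_eq_iff Omega_mult_left X_def vol)
  have "X \<in> sparse C"
  proof -
    have "z $ i $ j + z $ j $ i = 0" for i j using anti[of i j] by simp
    moreover have "z $ i $ j = 0" if "j \<notin> neighbours C i" for i j
      using that by (simp add: z mask_def)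
    ultimately show ?thesis
      using row by (auto simp: sparse_def diff_algebra_iff X_def vol simp flip: sum_divide_distrib)
  qed
  \<comment> \<open>Since \<open>z\<close> is masked, \<open>W\<close> may be replaced by
    \<open>mask W = y + z\<close>; with \<open>y\<close> orthogonal to \<open>z\<close> this leaves
    \<open>z \<bullet> z = 0\<close>.\<close>
  then have "W \<bullet> z = 0" using ortho[of X] by (simp add: pairing_inner OX)
  moreover have "W \<bullet> z = mask W \<bullet> z"
    unfolding inner_vec_def by (intro sum.cong refl) (auto simp: z mask_def)
  moreover have "y \<bullet> z = 0" using yz(1,2) by (simp add: orthogonal_def inner_commute)
  ultimately have "z = 0" by (simp add: yz(3) inner_add_left)
  then have mask_0: "mask (W - d0 p) $ i $ j = 0" for i j by (simp flip: z)
  have "W $ i $ j - d0 p $ i $ j = 0" if "j \<in> neighbours C i" for i j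
  proof -
    have "mask (W - d0 p) $ i $ j = W $ i $ j - d0 p $ i $ j"
      using that by (simp add: mask_def)
    then show ?thesis by (simp add: mask_0)
  qed
  \<comment> \<open>The decomposition gives \<open>W\<close> equal to \<open>d0 p\<close> on
    neighbours, so the pressure is \<open>- p\<close>.\<close>
  then show ?thesis
    by (intro exI[of _ "- p"]) (simp add: d0_def)
qed

text \<open>A sparse field sees only adjacent pairs, where the flat multiplies each entry by a
  weight independent of the field. The pairing is thus a weighted sum of the products
  \<open>X $ i $ j * Y $ i $ j\<close>.\<close>

lemma flat_symmetric:
  assumes "flat_operator C flat" "X \<in> sparse C" "Y \<in> sparse C"
  shows "pairing C (flat X) Y = pairing C (flat Y) X"
proof -
  have *: "pairing C (flat U) V =
      (\<Sum>i\<in>UNIV. \<Sum>j\<in>UNIV. vol C i * V $ i $ j * flat_adjacent C U i j)"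
    if "U \<in> sparse C" "V \<in> sparse C" for U V
  proof -
    have "V $ i $ j * flat U $ i $ j = V $ i $ j * flat_adjacent C U i j" for i j
      using that assms(1) by (cases "j \<in> neighbours C i") (auto simp: sparse_def flat_operator_def)
    then have "flat U $ i $ j * (vol C i * V $ i $ j) = vol C i * V $ i $ j * flat_adjacent C U i j"
      for i j by (metis mult.assoc mult.commute)
    then show ?thesis
      unfolding pairing_inner inner_vec_def
      by (intro sum.cong refl) (simp only: Omega_mult_left inner_real_def)
  qed
  show ?thesis
    by (simp add: *[OF assms(2,3)] *[OF assms(3,2)] flat_adjacent_def mult.commute mult.left_commute)
qed

section \<open>The variational principle\<close>

lemma bounded_bilinear_pairing: "bounded_bilinear (pairing C)"
  unfolding bilinear_conv_bounded_bilinear[symmetric] bilinear_def linear_iff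
  by (simp add: pairing_add_left pairing_add_right pairing_scaleR_left pairing_scaleR_right)

text \<open>The component \<open>z\<close> of the derivative orthogonal to \<open>S\<close>
  satisfies \<open>z \<bullet> f s = 0\<close> for all times \<open>s\<close>; differentiating this
  gives \<open>z \<bullet> z = 0\<close>.\<close>

lemma ddt_in_subspace:
  fixes f :: "real \<Rightarrow> 'b::euclidean_space"
  assumes "subspace S" "smooth01 f" "\<And>t. t \<in> {0..1} \<Longrightarrow> f t \<in> S" and t: "t \<in> {0..1}"
  shows "ddt f t \<in> S"
proof -
  have S: "span S = S" using assms(1) by (simp only: span_eq_iff)
  obtain y z where yz: "y \<in> span S" "\<And>w. w \<in> span S \<Longrightarrow> orthogonal z w" "ddt f t = y + z"
    using orthogonal_subspace_decomp_exists[of S "ddt f t"] by metis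
  have z: "z \<bullet> f s = 0" if "s \<in> {0..1}" for s
    using yz(2)[of "f s"] assms(3)[OF that] by (simp add: S orthogonal_def)
  have "((\<lambda>s. z \<bullet> f s) has_vector_derivative z \<bullet> ddt f t) (at t within {0..1})"
    by (rule bounded_linear.has_vector_derivative[OF bounded_linear_inner_right
          smooth01_has_ddt[OF assms(2) t]])
  then have "ddt (\<lambda>s. z \<bullet> f s) t = z \<bullet> ddt f t"
    by (rule ddt_eqI[OF t])
  moreover have "ddt (\<lambda>s. z \<bullet> f s) t = 0"
    by (intro ddt_eqI[OF t] has_vector_derivative_transform[OF t _ has_vector_derivative_const[of 0]] z)
  ultimately have "z \<bullet> z = 0"
    using yz(2)[OF yz(1)] by (simp add: yz(3) inner_add_right orthogonal_def)
  then show ?thesis using yz by (simp add: S)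
qed

text \<open>The explicit inverse turns the velocity into products of \<open>ddt q\<close>,
  \<open>transpose (q t)\<close> and constant matrices.\<close>

lemma smooth01_velocity:
  assumes "mesh C" "smooth01 q" "\<And>t. t \<in> {0..1} \<Longrightarrow> q t \<in> diff_group C"
  shows "smooth01 (velocity q)"
proof -
  define M where "M = (\<chi> i j. if i = j then inverse (vol C i) else 0)"
  note mult = bounded_bilinear_matrix_mult
  have "smooth01 (\<lambda>t. - (ddt q t ** (M ** (transpose (q t) ** Omega C))))"
    by (intro smooth01_bounded_linear[OF bounded_linear_minus[OF bounded_linear_ident]]
        smooth01_bounded_bilinear[OF mult] smooth01_ddt assms(2)
        smooth01_bounded_linear[OF bounded_bilinear.bounded_linear_right[OF mult]]
        smooth01_bounded_linear[OF bounded_bilinear.bounded_linear_left[OF mult]]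
        smooth01_bounded_linear[OF bounded_linear_transpose])
  then show ?thesis
    by (rule smooth01_cong)
      (simp add: velocity_def diff_group_inverse(1)[OF assms(1) assms(3)] M_def)
qed

text \<open>On a line the Lagrangian is a quadratic polynomial in \<epsilon>. Both mixed pairings
  remain, since the direction \<open>D\<close> need not be sparse.\<close>

lemma lagrangian_deriv:
  assumes "linear flat"
  shows "deriv (\<lambda>\<epsilon>. lagrangian C flat (A + \<epsilon> *\<^sub>R D)) 0
    = 1 / 2 * (pairing C (flat A) D + pairing C (flat D) A)"
proof -
  have "lagrangian C flat (A + \<epsilon> *\<^sub>R D) = 1 / 2 * (pairing C (flat A) A
      + \<epsilon> * (pairing C (flat A) D + pairing C (flat D) A) + \<epsilon>\<^sup>2 * pairing C (flat D) D)" for \<epsilon>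
    by (simp add: lagrangian_def linear_add[OF assms] linear_scale[OF assms] pairing_add_left
        pairing_add_right pairing_scaleR_left pairing_scaleR_right power2_eq_square algebra_simps)
  moreover have "((\<lambda>\<epsilon>. 1 / 2 * (a + \<epsilon> * b + \<epsilon>\<^sup>2 * c)) has_field_derivative 1 / 2 * b) (at 0)"
    for a b c :: real
    by (auto intro!: derivative_eq_intros)
  ultimately show ?thesis by (simp only: DERIV_imp_deriv)
qed

text \<open>
  Testing with \<open>B t = t (1 - t) g(t) X\<close>, where \<open>g\<close> is the smooth defect of the weak equation,
  turns the principle into \<open>\<integral> t (1 - t) g\<^sup>2 = 0\<close> after an integration by parts.
\<close>

lemma weak_euler:
  fixes C :: "'n::finite \<Rightarrow> 'a::euclidean_space set"
  assumes C: "mesh C" and flat: "flat_operator C flat"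
    and q: "smooth01 q" "\<And>t. t \<in> {0..1} \<Longrightarrow> q t \<in> diff_group C"
    and A: "A = velocity q" and ld: "lagrange_dalembert C flat q"
    and X: "X \<in> sparse C" and t: "t \<in> {0..1}"
  shows "pairing C (flat (A t)) (commutator (A t) X) = pairing C (flat (ddt A t)) X"
proof -
  define g where "g t = pairing C (flat (A t)) (commutator (A t) X) - pairing C (flat (ddt A t)) X" for t
  \<comment> \<open>The polynomial is t (1 - t), in the shape of \<open>smooth01_quadratic\<close>;
    it vanishes at both ends.\<close>
  define \<phi> where "\<phi> t = (0 + 1 * t + (- 1) * t * t) * g t" for t :: real
  \<comment> \<open>The sign makes the encoded field equal to
    \<open>\<phi> t *\<^sub>R X\<close>.\<close>
  define dq where "dq t = - (\<phi> t *\<^sub>R (X ** q t))" for t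
  have A_smooth: "smooth01 A" unfolding A by (rule smooth01_velocity[OF C q])
  have A_sparse: "A t \<in> sparse C" if "t \<in> {0..1}" for t
    using ld that by (simp add: lagrange_dalembert_def A)
  have lin: "linear flat" using flat by (simp add: flat_operator_def)
  then have blin: "bounded_linear flat" by (simp add: linear_conv_bounded_linear)
  note minus = smooth01_bounded_linear[OF bounded_linear_minus[OF bounded_linear_ident]]
  have pair1: "smooth01 (\<lambda>t. pairing C (flat (A t)) (commutator (A t) X))"
    by (intro smooth01_bounded_bilinear[OF bounded_bilinear_pairing] smooth01_bounded_linear[OF blin]
        smooth01_bounded_linear[OF bounded_bilinear.bounded_linear_left[OF bounded_bilinear_commutator]]
        A_smooth)
  have pair_X: "bounded_linear (\<lambda>U. pairing C (flat U) X)"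
    by (rule bounded_linear_compose[OF
        bounded_bilinear.bounded_linear_left[OF bounded_bilinear_pairing] blin])
  have g_smooth: "smooth01 g"
    using smooth01_add[OF pair1 minus[OF smooth01_bounded_linear[OF pair_X smooth01_ddt[OF A_smooth]]]]
    by (rule smooth01_cong) (simp add: g_def)
  have \<phi>_smooth: "smooth01 \<phi>"
    unfolding \<phi>_def
    by (rule smooth01_bounded_bilinear[OF bounded_bilinear_mult smooth01_quadratic g_smooth])
  have "smooth01 dq"
    unfolding dq_def
    by (intro minus smooth01_bounded_bilinear[OF bounded_bilinear_scaleR] \<phi>_smooth
        smooth01_bounded_linear[OF bounded_bilinear.bounded_linear_right[OF bounded_bilinear_matrix_mult]] q)
  have dq_inv: "dq t ** matrix_inv (q t) = - (\<phi> t *\<^sub>R X)" if "t \<in> {0..1}" for t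
    using diff_group_inverse(3)[OF C q(2)[OF that]]
    by (simp add: dq_def matrix_minus_left flip: scalar_matrix_assoc matrix_mul_assoc)
  have sparse_X: "- (c *\<^sub>R X) \<in> sparse C" for c
    using X subspace_sparse[of C] by (simp add: subspace_neg subspace_scale)
  have dq_tangent: "dq t \<in> sparse_tangent C (q t)" if "t \<in> {0..1}" for t
  proof -
    have "dq t = (- (\<phi> t *\<^sub>R X)) ** q t"
      by (simp add: dq_def matrix_minus_left flip: scalar_matrix_assoc)
    moreover have "- (\<phi> t *\<^sub>R X) \<in> diff_algebra C"
      using sparse_X by (simp add: sparse_def)
    ultimately show ?thesis
      using dq_inv[OF that] sparse_X by (auto simp: sparse_tangent_def tangent_def)
  qed
  have "dq 0 = 0" "dq 1 = 0" by (simp_all add: dq_def \<phi>_def)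
  with ld \<open>smooth01 dq\<close> dq_tangent
  have int0: "integral {0..1} (lagrangian_variation C flat q dq) = 0"
    by (simp add: lagrange_dalembert_def)
  have enc: "encoded q dq t = \<phi> t *\<^sub>R X" if "t \<in> {0..1}" for t
    by (simp add: encoded_def dq_inv[OF that])
  have ddt_enc: "ddt (encoded q dq) t = ddt \<phi> t *\<^sub>R X" if "t \<in> {0..1}" for t
    by (intro ddt_eqI[OF that] has_vector_derivative_transform[OF that enc]
        bounded_linear.has_vector_derivative[OF bounded_linear_scaleR_left]
        smooth01_has_ddt[OF \<phi>_smooth that])
  \<comment> \<open>This is the derivative of \<open>\<phi> t * pairing C (flat (A t)) X\<close>, so
    splitting it off performs the integration by parts.\<close>
  define D where "D t = \<phi> t * pairing C (flat (ddt A t)) X + ddt \<phi> t * pairing C (flat (A t)) X" for t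
  have var: "lagrangian_variation C flat q dq t = D t + \<phi> t * g t" if "t \<in> {0..1}" for t
  proof -
    note At = A_sparse[OF that]
    \<comment> \<open>The commutator may leave the sparse fields; here the symmetry convention in
      \<open>flat_operator\<close> enters, while \<open>flat_symmetric\<close> handles the term in
      \<open>X\<close>.\<close>
    have sym: "pairing C (flat (commutator (A t) X)) (A t) = pairing C (flat (A t)) (commutator (A t) X)"
      using flat At X by (simp add: flat_operator_def)
    have com: "commutator (A t) (\<phi> t *\<^sub>R X) = \<phi> t *\<^sub>R commutator (A t) X"
      by (rule bounded_bilinear.scaleR_right[OF bounded_bilinear_commutator])
    let ?V = "velocity_variation q dq t"
    have V: "?V = ddt \<phi> t *\<^sub>R X + \<phi> t *\<^sub>R commutator (A t) X"
      by (simp add: velocity_variation_def enc[OF that] ddt_enc[OF that] com flip: A)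
    have "lagrangian_variation C flat q dq t
        = 1 / 2 * (pairing C (flat (A t)) ?V + pairing C (flat ?V) (A t))"
      unfolding lagrangian_variation_def A by (rule lagrangian_deriv[OF lin])
    also have "\<dots> = pairing C (flat (A t)) ?V"
      by (simp add: V linear_add[OF lin] linear_scale[OF lin] pairing_add_left pairing_add_right
          pairing_scaleR_left pairing_scaleR_right sym flat_symmetric[OF flat X At])
    also have "\<dots> = D t + \<phi> t * g t"
      by (simp add: V pairing_add_right pairing_scaleR_right D_def g_def algebra_simps)
    finally show ?thesis .
  qed
  have "((\<lambda>t. \<phi> t * pairing C (flat (A t)) X) has_vector_derivative D t) (at t within {0..1})"
    if "t \<in> {0..1}" for t
    unfolding D_def
    by (intro has_vector_derivative_mult smooth01_has_ddt[OF _ that] \<phi>_smooth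
        bounded_linear.has_vector_derivative[OF pair_X] A_smooth)
  then have "(D has_integral \<phi> 1 * pairing C (flat (A 1)) X - \<phi> 0 * pairing C (flat (A 0)) X) {0..1}"
    by (intro fundamental_theorem_of_calculus) auto
  \<comment> \<open>The boundary terms vanish with \<phi>.\<close>
  then have D_int: "(D has_integral 0) {0..1}" by (simp add: \<phi>_def)
  have \<phi>g: "\<phi> t * g t = (t * (1 - t)) * (g t)\<^sup>2" for t
    by (simp add: \<phi>_def power2_eq_square algebra_simps)
  have cont: "continuous_on {0..1} (\<lambda>t. \<phi> t * g t)"
    by (intro continuous_on_mult smooth01_continuous_on \<phi>_smooth g_smooth)
  have "integral {0..1} (\<lambda>t. D t + \<phi> t * g t) = 0"
    using int0 integral_cong[of "{0..1}" "lagrangian_variation C flat q dq" "\<lambda>t. D t + \<phi> t * g t"] var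
    by simp
  moreover have "integral {0..1} (\<lambda>t. D t + \<phi> t * g t) = integral {0..1} (\<lambda>t. \<phi> t * g t)"
    using integral_add[OF has_integral_integrable[OF D_int] integrable_continuous_real[OF cont]]
      integral_unique[OF D_int] by simp
  ultimately have "integral {0..1} (\<lambda>t. \<phi> t * g t) = 0" by simp
  moreover have "\<phi> t * g t \<ge> 0" if "t \<in> {0..1}" for t
    unfolding \<phi>g using that by (intro mult_nonneg_nonneg) auto
  \<comment> \<open>A continuous nonnegative function with zero integral vanishes.\<close>
  ultimately have \<phi>g_0: "\<forall>t\<in>{0..1}. \<phi> t * g t = 0"
    using integral_eq_0_iff[OF cont] by simp
  have g_interior: "g s = 0" if "s \<in> {0<..<1}" for s
  proof -
    have "s * (1 - s) * (g s)\<^sup>2 = 0"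
      using that \<phi>g_0[THEN bspec, of s] by (simp only: \<phi>g) simp
    with that show ?thesis by simp
  qed
  \<comment> \<open>The factor t (1 - t) says nothing at the endpoints; continuity of
    \<open>g\<close> extends the conclusion to them.\<close>
  have "g t = 0"
    using continuous_constant_on_closure[of "{0<..<1::real}" g 0 t] smooth01_continuous_on[OF g_smooth] t
      g_interior by simp
  then show ?thesis by (simp add: g_def)
qed

theorem theorem1:
  fixes C :: "'n::finite \<Rightarrow> 'a::euclidean_space set"
    and flat :: "real^'n^'n \<Rightarrow> real^'n^'n"
    and q :: "real \<Rightarrow> real^'n^'n"
    and A :: "real \<Rightarrow> real^'n^'n"
  assumes "mesh C"
    and "flat_operator C flat"
    and "smooth01 q"
    and "\<forall>t\<in>{0..1}. q t \<in> diff_group C"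
    and "A = velocity q"
    and "lagrange_dalembert C flat q"
  shows "(\<exists>p :: real \<Rightarrow> real^'n. \<forall>t\<in>{0..1}. \<forall>i. \<forall>j\<in>neighbours C i.
            (flat (ddt A t) + lie_derivative (A t) (flat (A t)) + d0 (p t)) $ i $ j = 0)
       \<and> (\<forall>(p :: real \<Rightarrow> real^'n). \<forall>t\<in>{0..1}. \<forall>i. \<forall>j\<in>neighbours C i.
            (flat (ddt A t) + lie_derivative (A t) (flat (A t)) + d0 (p t)) $ i $ j = 0
            \<longleftrightarrow>
            ddt A t $ i $ j
              + face_area C i j / (2 * vol C i * vol C j * dual_length C i j)
                  * commutator (A t) (flat (A t) ** Omega C) $ i $ j
              + face_area C i j / (2 * vol C i * dual_length C i j) * (p t $ j - p t $ i) = 0)"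
proof (intro conjI allI ballI)
  have q: "\<And>t. t \<in> {0..1} \<Longrightarrow> q t \<in> diff_group C" using assms(4) by blast
  have A_sparse: "A t \<in> sparse C" if "t \<in> {0..1}" for t
    using assms(5,6) that by (simp add: lagrange_dalembert_def)
  then have A_alg: "A t \<in> diff_algebra C" if "t \<in> {0..1}" for t
    using that by (simp add: sparse_def)
  \<comment> \<open>\<open>flat_operator\<close> prescribes antisymmetry and adjacent values on
    sparse fields only, so the flat of the derivative needs this.\<close>
  have ddt_sparse: "ddt A t \<in> sparse C" if "t \<in> {0..1}" for t
  proof (rule ddt_in_subspace[OF subspace_sparse])
    show "smooth01 A" unfolding assms(5) by (rule smooth01_velocity[OF assms(1,3) q])
  qed (use A_sparse that in auto)
  have flat_form: "one_form (flat X)" if "X \<in> sparse C" for X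
    using assms(2) that by (simp add: flat_operator_def)

  \<comment> \<open>Existence of the pressure\<close>
  have "\<forall>t\<in>{0..1}. \<exists>p. \<forall>i. \<forall>j\<in>neighbours C i.
      (flat (ddt A t) + lie_derivative (A t) (flat (A t))) $ i $ j + d0 p $ i $ j = 0"
  proof (intro ballI gradient_on_neighbours[OF assms(1)])
    fix t :: real assume t: "t \<in> {0..1}"
    note F = flat_form[OF A_sparse[OF t]]
    show "one_form (flat (ddt A t) + lie_derivative (A t) (flat (A t)))"
      using flat_form[OF ddt_sparse[OF t]] one_form_lie_derivative[OF A_alg[OF t] F]
      by (simp add: one_form_transpose transpose_add)
    fix X assume "X \<in> sparse C"
    from weak_euler[OF assms(1,2,3) q assms(5,6) this t]
    show "pairing C (flat (ddt A t) + lie_derivative (A t) (flat (A t))) X = 0"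
      by (simp add: pairing_add_left pairing_commutator[OF A_alg[OF t] F])
  qed
  \<comment> \<open>The pressure is chosen separately at each time; no regularity in time is
    asserted.\<close>
  from bchoice[OF this] obtain p where "\<forall>t\<in>{0..1}. \<forall>i. \<forall>j\<in>neighbours C i.
      (flat (ddt A t) + lie_derivative (A t) (flat (A t))) $ i $ j + d0 (p t) $ i $ j = 0"
    by (elim exE)
  then show "\<exists>p :: real \<Rightarrow> real^'n. \<forall>t\<in>{0..1}. \<forall>i. \<forall>j\<in>neighbours C i.
      (flat (ddt A t) + lie_derivative (A t) (flat (A t)) + d0 (p t)) $ i $ j = 0"
    by (intro exI[of _ p]) simp

  \<comment> \<open>Equivalence of the two forms of the equation\<close>
  fix p :: "real \<Rightarrow> real^'n" and t :: real and i j
  assume t: "t \<in> {0..1}" and j: "j \<in> neighbours C i"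
  \<comment> \<open>The inverse of the weight in \<open>flat_adjacent\<close>.\<close>
  define c where "c = face_area C i j / (2 * vol C i * dual_length C i j)"
  have pos: "0 < face_area C i j" "0 < dual_length C i j" "0 < vol C i" "0 < vol C j"
    using face_area_pos dual_length_pos vol_pos assms(1) j by blast+
  then have "c \<noteq> 0" by (simp add: c_def)
  have "flat (ddt A t) $ i $ j = flat_adjacent C (ddt A t) i j"
    using assms(2) ddt_sparse[OF t] j by (simp add: flat_operator_def)
  then have ddt: "ddt A t $ i $ j = c * flat (ddt A t) $ i $ j"
    using pos by (simp add: flat_adjacent_def c_def)
  \<comment> \<open>The extra \<open>vol C j\<close> in the denominator cancels the column factor
    from \<open>lie_derivative_commutator\<close>.\<close>
  have lie: "face_area C i j / (2 * vol C i * vol C j * dual_length C i j)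
      * commutator (A t) (flat (A t) ** Omega C) $ i $ j
      = c * lie_derivative (A t) (flat (A t)) $ i $ j"
    using pos
    by (simp add: c_def lie_derivative_commutator[OF A_alg[OF t] flat_form[OF A_sparse[OF t]]])
  have "ddt A t $ i $ j
      + face_area C i j / (2 * vol C i * vol C j * dual_length C i j)
        * commutator (A t) (flat (A t) ** Omega C) $ i $ j
      + face_area C i j / (2 * vol C i * dual_length C i j) * (p t $ j - p t $ i)
      = c * (flat (ddt A t) + lie_derivative (A t) (flat (A t)) + d0 (p t)) $ i $ j"
    unfolding lie c_def[symmetric] by (simp add: ddt d0_def algebra_simps)
  with \<open>c \<noteq> 0\<close> show "(flat (ddt A t) + lie_derivative (A t) (flat (A t)) + d0 (p t)) $ i $ j = 0
      \<longleftrightarrow> ddt A t $ i $ j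
      + face_area C i j / (2 * vol C i * vol C j * dual_length C i j)
        * commutator (A t) (flat (A t) ** Omega C) $ i $ j
      + face_area C i j / (2 * vol C i * dual_length C i j) * (p t $ j - p t $ i) = 0"
    by simp
qed

end
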